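(* Let $F:\mathbb R^n\to\mathbb R$ be convex and $C^2$, and let $\varphi:\mathbb R^n\to\mathbb R$ be a $C^1$, $1$-strongly convex function whose conjugate $\varphi^*$ is $C^2$. Consider the accelerated mirror descent method, for $k\ge0$, $$\left\{\begin{aligned}y_{k+1}&=\operatorname*{argmin}_{y\in\mathbb R^n}\left\{s\langle\nabla F(x_k),y-x_k\rangle+\tfrac12\|y-x_k\|^2\right\},\\ \hat z_{k+1}&=\operatorname*{argmin}_{z\in\mathbb R^n}\left\{\tfrac1s\varphi(z)+\sum_{i=0}^k\tfrac{i+1}{2}\left[F(x_i)+\langle\nabla F(x_i),z-x_i\rangle\right]\right\},\\ x_{k+1}&=\tfrac{2}{k+3}\hat z_{k+1}+\tfrac{k+1}{k+3}y_{k+1},\end{aligned}\right.$$ and its equivalent template $X_{k+1}=\Phi_{\rm amd}(X_k,\sqrt{s})$, where $X_k=(x_k,z_k,t_k)$ with $z_k=\nabla\varphi(\hat z_k)$ (and $z_0=0$), $t_k=(k+3)\sqrt{s}$ and, for $X=(x,z,t)$ with $t>0$, $$\Phi_{\rm amd}(X,\tau)=\begin{bmatrix}\left(1-\frac{2\tau}{t}\right)x+\frac{2\tau}{t}\nabla\varphi^*\!\left(z-\tau(t/2-\tau)\nabla F(x)\right)-\tau^2\left(1-\frac{2\tau}{t}\right)\nabla F(x)\\ z-\tau(t/2-\tau)\nabla F(x)\\ t+\tau\end{bmatrix}.$$ Then the $O(\sqrt{s})$-resolution ODE of the method with respect to this template is $$\begin{bmatrix} x \\ z \\ t \end{bmatrix}'=\begin{bmatrix}\frac2t(\nabla\varphi^*(z)-x)\\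 -\frac t2\nabla F(x)\\ 1\end{bmatrix}+\frac{\sqrt{s}}{2}\begin{bmatrix}-\nabla^2\varphi^*(z)\nabla F(x)-2\nabla F(x)+\frac{6}{t^2}(\nabla\varphi^*(z)-x)\\ \frac52\nabla F(x)+\nabla^2F(x)(\nabla\varphi^*(z)-x)\\ 0\end{bmatrix}.$$
   Context: Definition: given a template $X^+=\Phi(X,\sqrt{s})$ with $\Phi(X,0)=X$ for all $X$, an ODE $X'=\Gamma_0(X)+\sqrt{s}\,\Gamma_1(X)$ with initial value $X$ and $\Gamma_0,\Gamma_1$ independent of $s$ is the $O(\sqrt{s})$-resolution ODE with respect to the template if for every $X$ its solution, evaluated at time $\sqrt{s}$, differs from $X^+$ by $o\big((\sqrt{s})^{2}\big)=o(s)$ in norm as $s\to0^+$. Here $X=(x,z,t)\in\mathbb R^n\times\mathbb R^n\times(0,\infty)$; the third component $t$ is itself a state variable. *)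

theory Defs
  imports "HOL-Analysis.Analysis"
begin

definition grad :: "('a::real_inner \<Rightarrow> real) \<Rightarrow> 'a \<Rightarrow> 'a" where
  "grad f x = (THE D. GDERIV f x :> D)"

definition hessian :: "(real^'n \<Rightarrow> real) \<Rightarrow> real^'n \<Rightarrow> real^'n^'n" where
  "hessian f x = jacobian (grad f) (at x)"

definition C1 :: "(real^'n \<Rightarrow> real) \<Rightarrow> bool" where
  "C1 f \<longleftrightarrow> (\<forall>x. f differentiable at x) \<and> continuous_on UNIV (grad f)"

definition C2 :: "(real^'n \<Rightarrow> real) \<Rightarrow> bool" where
  "C2 f \<longleftrightarrow> C1 f \<and> (\<forall>x. grad f differentiable at x) \<and> continuous_on UNIV (hessian f)"

definition strongly_convex :: "real \<Rightarrow> ('a::real_inner \<Rightarrow> real) \<Rightarrow> bool" where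
  "strongly_convex \<mu> f \<longleftrightarrow>
     (\<forall>x y. \<forall>u\<in>{0..1}.
        f ((1 - u) *\<^sub>R x + u *\<^sub>R y)
          \<le> (1 - u) * f x + u * f y - \<mu> / 2 * u * (1 - u) * (norm (x - y))\<^sup>2)"

text \<open>The supremum is taken in the reals, so it is only meaningful where it is finite. For a
  strongly convex function on a Euclidean space it is finite everywhere.\<close>

definition conjugate :: "('a::real_inner \<Rightarrow> real) \<Rightarrow> 'a \<Rightarrow> real" where
  "conjugate f p = (SUP x. p \<bullet> x - f x)"

definition ode_solution :: "'b::real_normed_vector set \<Rightarrow> ('b \<Rightarrow> 'b) \<Rightarrow> 'b \<Rightarrow> real \<Rightarrow> (real \<Rightarrow> 'b) \<Rightarrow> bool" where
  "ode_solution D \<Gamma> X0 T Y \<longleftrightarrow>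
     Y 0 = X0 \<and>
     (\<forall>r\<in>{0..T}. Y r \<in> D \<and> (Y has_vector_derivative \<Gamma> (Y r)) (at r within {0..T}))"

text \<open>The template is a map of the state and of \<open>\<tau> = sqrt s\<close>. The vector fields need not be
  Lipschitz, so the solution of the ODE need not be unique. We demand that, for all small \<open>s\<close>,
  a solution exists up to time \<open>sqrt s\<close>, and that the \<open>o(s)\<close> bound holds uniformly over all
  solutions; when the solution is unique this is the usual statement about it.\<close>

definition resolution_ode ::
    "'b::real_normed_vector set \<Rightarrow> ('b \<Rightarrow> real \<Rightarrow> 'b) \<Rightarrow> ('b \<Rightarrow> 'b) \<Rightarrow> ('b \<Rightarrow> 'b) \<Rightarrow> bool" where
  "resolution_ode D \<Phi> \<Gamma>0 \<Gamma>1 \<longleftrightarrow>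
     (\<forall>X\<in>D. \<Phi> X 0 = X) \<and>
     (\<forall>X\<in>D. \<forall>\<epsilon>>0. \<forall>\<^sub>F s in at_right 0.
        (\<exists>Y. ode_solution D (\<lambda>Z. \<Gamma>0 Z + sqrt s *\<^sub>R \<Gamma>1 Z) X (sqrt s) Y) \<and>
        (\<forall>Y. ode_solution D (\<lambda>Z. \<Gamma>0 Z + sqrt s *\<^sub>R \<Gamma>1 Z) X (sqrt s) Y \<longrightarrow>
           norm (Y (sqrt s) - \<Phi> X (sqrt s)) \<le> \<epsilon> * s))"

definition amd_method ::
    "('a::real_inner \<Rightarrow> real) \<Rightarrow> ('a \<Rightarrow> real) \<Rightarrow> real \<Rightarrow>
     (nat \<Rightarrow> 'a) \<Rightarrow> (nat \<Rightarrow> 'a) \<Rightarrow> (nat \<Rightarrow> 'a) \<Rightarrow> bool" where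
  "amd_method F \<phi> s x y zh \<longleftrightarrow>
     (\<forall>k. is_arg_min (\<lambda>v. s * (grad F (x k) \<bullet> (v - x k)) + 1/2 * (norm (v - x k))\<^sup>2)
            (\<lambda>_. True) (y (Suc k)) \<and>
          is_arg_min (\<lambda>v. 1 / s * \<phi> v +
              (\<Sum>i=0..k. (real i + 1) / 2 * (F (x i) + grad F (x i) \<bullet> (v - x i))))
            (\<lambda>_. True) (zh (Suc k)) \<and>
          x (Suc k) = (2 / (real k + 3)) *\<^sub>R zh (Suc k) + ((real k + 1) / (real k + 3)) *\<^sub>R y (Suc k))"

text \<open>The state sequences \<open>X\<^sub>k = (x\<^sub>k, z\<^sub>k, t\<^sub>k)\<close> produced by runs of the method. The method does
  not use \<open>zh 0\<close>; it is normalised by \<open>grad \<phi> (zh 0) = z\<^sub>0 = 0\<close>.\<close>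

definition amd_states ::
    "('a::real_inner \<Rightarrow> real) \<Rightarrow> ('a \<Rightarrow> real) \<Rightarrow> real \<Rightarrow> (nat \<Rightarrow> 'a \<times> 'a \<times> real) \<Rightarrow> bool" where
  "amd_states F \<phi> s X \<longleftrightarrow>
     (\<exists>x y zh z. amd_method F \<phi> s x y zh \<and>
        z 0 = 0 \<and> (\<forall>k. z k = grad \<phi> (zh k)) \<and>
        (\<forall>k. X k = (x k, z k, (real k + 3) * sqrt s)))"

definition amd_template ::
    "('a::real_inner \<Rightarrow> real) \<Rightarrow> ('a \<Rightarrow> real) \<Rightarrow> 'a \<times> 'a \<times> real \<Rightarrow> real \<Rightarrow> 'a \<times> 'a \<times> real" where
  "amd_template F \<phi> = (\<lambda>(x, z, t) \<tau>.
     ((1 - 2 * \<tau> / t) *\<^sub>R x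
        + (2 * \<tau> / t) *\<^sub>R grad (conjugate \<phi>) (z - (\<tau> * (t / 2 - \<tau>)) *\<^sub>R grad F x)
        - (\<tau>\<^sup>2 * (1 - 2 * \<tau> / t)) *\<^sub>R grad F x,
      z - (\<tau> * (t / 2 - \<tau>)) *\<^sub>R grad F x,
      t + \<tau>))"

end

theory Submission
  imports Defs
begin

text \<open>A solution of \<open>X' = \<Gamma>0 X + \<tau> \<Gamma>1 X\<close> evaluated at time \<open>\<tau>\<close> expands as
  \<open>X + \<tau> \<Gamma>0 X + \<tau>\<^sup>2 (\<Gamma>1 X + D\<Gamma>0(X) \<Gamma>0(X) / 2) + o(\<tau>\<^sup>2)\<close>: a bootstrap from \<open>Y r - X = O(r)\<close>
  shows this for every solution, with only \<open>\<Gamma>0\<close> differentiable and \<open>\<Gamma>1\<close> continuous. The resolution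
  ODE is thus read off the second-order expansion of the template in \<open>\<tau>\<close>.

  The Hessians in \<open>\<Gamma>1\<close> are merely continuous, so existence of a solution needs Peano's theorem.
  It is obtained from Euler step functions by taking a cluster point in the topology of pointwise
  convergence (Tychonoff). Pointwise closeness at the two end points of an interval controls the
  difference quotient there, because all intermediate Euler slopes lie near a single value; hence
  no uniform convergence is required.

  For a differentiable strongly convex \<open>\<phi>\<close> the maps \<open>grad \<phi>\<close> and \<open>grad (conjugate \<phi>)\<close> are inverse to
  each other, so the optimality conditions of the two argmin steps are exactly the template.\<close>

subsection \<open>Peano existence\<close>

text \<open>The product of the \<open>K i\<close> is compact by Tychonoff, so the sequence has a
  cluster point. For an index set as large as the reals this does not yield a pointwise convergent
  subsequence, hence the weak conclusion: a neighbourhood in the product topology constrains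
  finitely many coordinates, and two are enough for one chord.\<close>

lemma pointwise_cluster_point:
  fixes E :: "nat \<Rightarrow> 'i \<Rightarrow> 'a::euclidean_space"
  assumes "\<And>n i. E n i \<in> K i" and "\<And>i. compact (K i)"
  obtains Y where "\<And>i. Y i \<in> K i"
    and "\<And>a b N \<delta>. \<delta> > 0 \<Longrightarrow> \<exists>n\<ge>N. norm (E n a - Y a) < \<delta> \<and> norm (E n b - Y b) < \<delta>"
proof -
  have "compactin (product_topology (\<lambda>i. euclidean) UNIV) (PiE UNIV K)"
    using assms(2) by (simp add: compactin_PiE)
  then have "compact (PiE UNIV K)"
    by (simp add: euclidean_product_topology)
  moreover have "filtermap E sequentially \<noteq> bot"
    by (simp add: filtermap_bot_iff)
  moreover have "eventually (\<lambda>x. x \<in> PiE UNIV K) (filtermap E sequentially)"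
    using assms(1) by (auto simp: eventually_filtermap intro!: always_eventually)
  ultimately obtain Y where Y: "Y \<in> PiE UNIV K" "inf (nhds Y) (filtermap E sequentially) \<noteq> bot"
    unfolding compact_filter by blast
  show thesis
  proof
    show "Y i \<in> K i" for i using Y(1) by auto
    fix a b :: 'i and N :: nat and \<delta> :: real assume "\<delta> > 0"
    define U where "U = {f. f a \<in> ball (Y a) \<delta>} \<inter> {f. f b \<in> ball (Y b) \<delta>}"
    have ope: "open {f :: 'i \<Rightarrow> 'a. f i \<in> ball (Y i) \<delta>}" for i
      using open_vimage[OF open_ball continuous_on_product_coordinates[of i]] by (simp add: vimage_def)
    then have "open U" unfolding U_def by blast
    moreover have "Y \<in> U" using \<open>\<delta> > 0\<close> by (simp add: U_def)
    ultimately have ev: "eventually (\<lambda>f. f \<in> U) (nhds Y)" by (simp add: eventually_nhds_in_open)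
    show "\<exists>n\<ge>N. norm (E n a - Y a) < \<delta> \<and> norm (E n b - Y b) < \<delta>"
    proof (rule ccontr)
      assume "\<not> ?thesis"
      then have "\<forall>n\<ge>N. E n \<notin> U" by (auto simp: U_def dist_norm norm_minus_commute)
      then have "eventually (\<lambda>f. f \<notin> U) (filtermap E sequentially)"
        by (auto simp: eventually_filtermap eventually_sequentially)
      then have "eventually (\<lambda>_. False) (inf (nhds Y) (filtermap E sequentially))"
        using ev unfolding eventually_inf by blast
      then show False using Y(2) by (simp add: eventually_False)
    qed
  qed
qed

lemma euler_steps:
  fixes G :: "'a::real_normed_vector \<Rightarrow> 'a"
  assumes step: "\<And>k. e (Suc k) = e k + h *\<^sub>R G (e k)" and h: "h \<ge> 0"
    and "j \<le> k" and "\<And>i. j \<le> i \<Longrightarrow> i < k \<Longrightarrow> norm (G (e i) - v) \<le> \<eta>"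
  shows "norm (e k - e j - (real (k - j) * h) *\<^sub>R v) \<le> real (k - j) * h * \<eta>"
  using assms(3,4)
proof (induction k rule: dec_induct)
  case base
  then show ?case by simp
next
  case (step k)
  have "e (Suc k) - e j - (real (Suc k - j) * h) *\<^sub>R v
      = (e k - e j - (real (k - j) * h) *\<^sub>R v) + h *\<^sub>R (G (e k) - v)"
    using step.hyps by (simp add: assms(1) Suc_diff_le algebra_simps)
  also have "norm \<dots> \<le> real (k - j) * h * \<eta> + h * \<eta>"
    using step h by (intro norm_triangle_mono) (auto intro!: mult_left_mono)
  finally show ?case
    using step.hyps by (simp add: Suc_diff_le algebra_simps)
qed

text \<open>Passes from grid indices to real times. Rounding both ends down to the grid changes the
  elapsed time by at most \<open>h\<close>, which costs \<open>h * norm v\<close>. The anchor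
  \<open>c\<close> may be either end, since a derivative at \<open>c\<close> is tested from both
  sides; \<open>near\<close> is a local condition because an Euler path of speed at most
  \<open>M\<close> stays that close to its anchor.\<close>

lemma euler_chord:
  fixes G :: "'a::real_normed_vector \<Rightarrow> 'a"
  assumes step: "\<And>k. e (Suc k) = e k + h *\<^sub>R G (e k)" and h: "h > 0"
    and M: "\<And>x. norm (G x) \<le> M" and \<eta>: "\<eta> \<ge> 0"
    and ab: "0 \<le> a" "a \<le> b" and c: "c = a \<or> c = b"
    and near: "\<And>x. norm (x - e (nat \<lfloor>c / h\<rfloor>)) \<le> (b - a + h) * M \<Longrightarrow> norm (G x - v) \<le> \<eta>"
  shows "norm (e (nat \<lfloor>b / h\<rfloor>) - e (nat \<lfloor>a / h\<rfloor>) - (b - a) *\<^sub>R v) \<le> (b - a + h) * \<eta> + h * norm v"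
proof -
  define j k where "j = nat \<lfloor>a / h\<rfloor>" and "k = nat \<lfloor>b / h\<rfloor>"
  have M0: "M \<ge> 0" using M[of 0] norm_ge_zero order_trans by blast
  have jk: "j \<le> k" unfolding j_def k_def
    using ab h by (intro nat_mono floor_mono divide_right_mono) auto
  have j: "real j \<le> a / h" "a / h < real j + 1"
    unfolding j_def using ab h by (auto simp: of_nat_nat floor_le_iff)
  have k: "real k \<le> b / h" "b / h < real k + 1"
    unfolding k_def using ab h by (auto simp: of_nat_nat floor_le_iff)
  have j': "real j * h \<le> a" "a < real j * h + h" and k': "real k * h \<le> b" "b < real k * h + h"
    using j k h by (auto simp: field_simps)
  have d: "real (k - j) * h = real k * h - real j * h"
    using jk by (simp add: of_nat_diff algebra_simps)
  have len: "real (k - j) * h \<le> b - a + h" "\<bar>real (k - j) * h - (b - a)\<bar> \<le> h"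
    using j' k' unfolding d by auto
  \<comment> \<open>Reference slope 0 and tolerance \<open>M\<close> in \<open>euler_steps\<close>
    bound the distance travelled.\<close>
  have lip: "norm (e q - e p) \<le> (b - a + h) * M" if "j \<le> p" "p \<le> q" "q \<le> k" for p q
  proof -
    have "norm (e q - e p - (real (q - p) * h) *\<^sub>R 0) \<le> real (q - p) * h * M"
      using that M h by (intro euler_steps[where G = G] step) auto
    moreover have "real (q - p) * h \<le> real (k - j) * h"
      using that h by (intro mult_right_mono) auto
    ultimately show ?thesis
      using len(1) M0 by (smt (verit) mult_right_mono scaleR_zero_right diff_zero)
  qed
  have "norm (G (e i) - v) \<le> \<eta>" if "j \<le> i" "i < k" for i
  proof (rule near)
    show "norm (e i - e (nat \<lfloor>c / h\<rfloor>)) \<le> (b - a + h) * M"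
      using c lip[of j i] lip[of i k] that by (auto simp: j_def k_def norm_minus_commute)
  qed
  then have "norm (e k - e j - (real (k - j) * h) *\<^sub>R v) \<le> real (k - j) * h * \<eta>"
    using jk h by (intro euler_steps[where G = G] step) auto
  also have "\<dots> \<le> (b - a + h) * \<eta>" using len \<eta> by (intro mult_right_mono)
  finally have 1: "norm (e k - e j - (real (k - j) * h) *\<^sub>R v) \<le> (b - a + h) * \<eta>" .
  have 2: "norm ((real (k - j) * h - (b - a)) *\<^sub>R v) \<le> h * norm v"
    using len(2) by (simp add: mult_right_mono)
  have "e k - e j - (b - a) *\<^sub>R v
      = (e k - e j - (real (k - j) * h) *\<^sub>R v) + (real (k - j) * h - (b - a)) *\<^sub>R v"
    by (simp add: algebra_simps)
  then show ?thesis
    using norm_triangle_mono[OF 1 2] unfolding j_def[symmetric] k_def[symmetric] by metis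
qed

text \<open>The global bound \<open>M\<close> confines all Euler paths at time \<open>r\<close> to
  one compact ball, so a pointwise cluster point \<open>Y\<close> exists. Its chords inherit the
  slope estimate of the Euler paths, and this already is differentiability with the right
  derivative.\<close>

lemma peano_bounded:
  fixes G :: "'a::euclidean_space \<Rightarrow> 'a"
  assumes cont: "continuous_on UNIV G" and M: "\<And>x. norm (G x) \<le> M"
  obtains Y where "Y 0 = X" and "\<And>r. r \<ge> 0 \<Longrightarrow> norm (Y r - X) \<le> M * r"
    and "\<And>r. r \<ge> 0 \<Longrightarrow> (Y has_vector_derivative G (Y r)) (at r within {0..})"
proof -
  have M0: "M \<ge> 0" using M[of 0] norm_ge_zero order_trans by blast
  define h where "h n = inverse (real (Suc n))" for n
  have h: "h n > 0" for n by (simp add: h_def)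
  define e where "e n k = ((\<lambda>x. x + h n *\<^sub>R G x) ^^ k) X" for n k
  have e0: "e n 0 = X" and step: "e n (Suc k) = e n k + h n *\<^sub>R G (e n k)" for n k
    by (auto simp: e_def)
  define E where "E n r = e n (nat \<lfloor>r / h n\<rfloor>)" for n and r :: real
  \<comment> \<open>The indices are all reals, so negative times need a compact set too: there
    \<open>nat\<close> sends the negative floor to 0 and \<open>E n r\<close> is
    \<open>X\<close>.\<close>
  define K where "K r = cball X (M * max 0 r)" for r
  have "E n r \<in> K r" for n r
  proof -
    define k where "k = nat \<lfloor>r / h n\<rfloor>"
    have "norm (e n k - e n 0 - (real (k - 0) * h n) *\<^sub>R 0) \<le> real (k - 0) * h n * M"
      using M h[of n] by (intro euler_steps[where G = G] step) auto
    moreover have "real k * h n \<le> max 0 r"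
    proof (cases "r \<ge> 0")
      case True
      then have "real k \<le> r / h n" using h[of n] by (simp add: k_def)
      then show ?thesis using h[of n] by (simp add: field_simps)
    next
      case False
      then have "r / h n < 0" using h[of n] by (simp add: field_simps)
      then have "k = 0" by (simp add: k_def)
      then show ?thesis by simp
    qed
    then have "real k * h n * M \<le> M * max 0 r"
      using M0 by (metis mult.commute mult_left_mono)
    ultimately show ?thesis
      by (simp add: E_def K_def e0 dist_norm norm_minus_commute flip: k_def)
  qed
  moreover have "compact (K r)" for r by (simp add: K_def)
  ultimately obtain Y where Y: "\<And>r. Y r \<in> K r"
    and clus: "\<And>a b N \<delta>. \<delta> > 0 \<Longrightarrow> \<exists>n\<ge>N. norm (E n a - Y a) < \<delta> \<and> norm (E n b - Y b) < \<delta>"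
    using pointwise_cluster_point[of E K] by blast
  show thesis
  proof
    show "Y 0 = X" using Y[of 0] by (simp add: K_def)
    fix r :: real assume r: "r \<ge> 0"
    show "norm (Y r - X) \<le> M * r"
      using Y[of r] r by (simp add: K_def dist_norm norm_minus_commute)
    show "(Y has_vector_derivative G (Y r)) (at r within {0..})"
      unfolding has_vector_derivative_def has_derivative_within_alt
    proof (intro conjI allI impI)
      show "bounded_linear (\<lambda>x. x *\<^sub>R G (Y r))" by (rule bounded_linear_scaleR_left)
      fix \<epsilon> :: real assume \<epsilon>: "\<epsilon> > 0"
      have "isCont G (Y r)" using cont by (simp add: continuous_on_eq_continuous_at)
      then obtain \<delta> where \<delta>: "\<delta> > 0" "\<And>x. norm (x - Y r) < \<delta> \<Longrightarrow> norm (G x - G (Y r)) < \<epsilon>"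
        using \<epsilon> unfolding continuous_at_eps_delta dist_norm by blast
      \<comment> \<open>Within time \<open>d\<close> a path of speed \<open>M\<close> moves at most
        \<delta> / 2. Grid rounding and the distance from \<open>E n r\<close> to \<open>Y r\<close>
        use less than \<delta> / 4 each, so all relevant Euler points lie within \<delta> of
        \<open>Y r\<close>.\<close>
      define d where "d = \<delta> / (2 * (M + 1))"
      have d: "d > 0" "d * M \<le> \<delta> / 2" using \<delta> M0 by (auto simp: d_def field_simps)
      have main: "norm (Y b - Y a - (b - a) *\<^sub>R G (Y r)) \<le> \<epsilon> * (b - a)"
        if ab: "0 \<le> a" "a \<le> b" "b - a < d" and rab: "r = a \<or> r = b" for a b
      proof (rule field_le_epsilon)
        fix \<kappa> :: real assume \<kappa>: "\<kappa> > 0"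
        \<comment> \<open>With \<open>h n * C\<close> below \<theta>, the rounding costs
          \<open>h n * M\<close> and \<open>h n * (\<epsilon> + norm (G (Y r)))\<close> are both
          below \<theta>. The total extra error is less than 3 \<theta>, at most 3/4 of
          \<kappa>.\<close>
        define C where "C = M + \<epsilon> + norm (G (Y r)) + 1"
        have C: "C > 0" using M0 \<epsilon> by (simp add: C_def add_nonneg_pos add_pos_nonneg)
        define \<theta> where "\<theta> = min (\<delta> / 4) (\<kappa> / 4)"
        have \<theta>: "\<theta> > 0" "\<theta> \<le> \<delta> / 4" "\<theta> \<le> \<kappa> / 4" using \<delta> \<kappa> by (auto simp: \<theta>_def)
        obtain N where N: "inverse (real (Suc N)) < \<theta> / C"
          using reals_Archimedean[of "\<theta> / C"] \<theta> C by auto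
        obtain n where n: "n \<ge> N" "norm (E n a - Y a) < \<theta>" "norm (E n b - Y b) < \<theta>"
          using clus[OF \<theta>(1)] by blast
        have "h n \<le> inverse (real (Suc N))"
          unfolding h_def using n(1) by (intro le_imp_inverse_le) auto
        then have hC: "h n * C < \<theta>" using N C by (simp add: pos_less_divide_eq[symmetric])
        have hM: "h n * M \<le> h n * C" and hv: "h n * (\<epsilon> + norm (G (Y r))) \<le> h n * C"
          using h[of n] M0 \<epsilon> by (auto simp: C_def)
        have En: "norm (E n r - Y r) < \<theta>" using n rab by auto
        have "norm (E n b - E n a - (b - a) *\<^sub>R G (Y r)) \<le> (b - a + h n) * \<epsilon> + h n * norm (G (Y r))"
          unfolding E_def
        proof (rule euler_chord[where G = G and e = "e n" and c = r, OF step h M _ ab(1,2) rab])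
          fix x assume x: "norm (x - e n (nat \<lfloor>r / h n\<rfloor>)) \<le> (b - a + h n) * M"
          have "norm (x - Y r) \<le> norm (x - E n r) + norm (E n r - Y r)"
            by (metis dist_norm dist_triangle)
          also have "\<dots> < (b - a + h n) * M + \<theta>" using x En by (simp add: E_def)
          also have "(b - a + h n) * M \<le> \<delta> / 2 + \<theta>"
          proof -
            have "(b - a) * M \<le> d * M" using ab M0 by (intro mult_right_mono) auto
            then show ?thesis using d hC hM by (simp add: algebra_simps)
          qed
          finally show "norm (G x - G (Y r)) \<le> \<epsilon>" using \<delta>(2)[of x] \<theta>(2) by linarith
        qed (use \<epsilon> in auto)
        moreover have "Y b - Y a - (b - a) *\<^sub>R G (Y r)
            = (E n b - E n a - (b - a) *\<^sub>R G (Y r)) - (E n b - Y b) + (E n a - Y a)"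
          by simp
        then have "norm (Y b - Y a - (b - a) *\<^sub>R G (Y r))
            \<le> norm (E n b - E n a - (b - a) *\<^sub>R G (Y r)) + norm (E n b - Y b) + norm (E n a - Y a)"
          by (metis (no_types) norm_triangle_mono[OF norm_triangle_ineq4 order_refl])
        ultimately have "norm (Y b - Y a - (b - a) *\<^sub>R G (Y r))
            \<le> \<epsilon> * (b - a) + h n * (\<epsilon> + norm (G (Y r))) + 2 * \<theta>"
          using n by (simp add: algebra_simps)
        then show "norm (Y b - Y a - (b - a) *\<^sub>R G (Y r)) \<le> \<epsilon> * (b - a) + \<kappa>"
          using hv hC \<theta>(3) \<kappa> by linarith
      qed
      show "\<exists>d>0. \<forall>y\<in>{0..}. norm (y - r) < d \<longrightarrow>
          norm (Y y - Y r - (y - r) *\<^sub>R G (Y r)) \<le> \<epsilon> * norm (y - r)"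
      proof (intro exI[of _ d] conjI ballI impI d)
        fix y assume y: "y \<in> {0::real..}" "norm (y - r) < d"
        show "norm (Y y - Y r - (y - r) *\<^sub>R G (Y r)) \<le> \<epsilon> * norm (y - r)"
        proof (cases "r \<le> y")
          case True
          then show ?thesis using main[of r y] y r by simp
        next
          case False
          then have "norm (Y r - Y y - (r - y) *\<^sub>R G (Y r)) \<le> \<epsilon> * (r - y)"
            using main[of y r] y by simp
          moreover have "Y y - Y r - (y - r) *\<^sub>R G (Y r) = - (Y r - Y y - (r - y) *\<^sub>R G (Y r))"
            by (simp add: algebra_simps)
          ultimately show ?thesis
            using False by (simp only: norm_minus_cancel) simp
        qed
      qed
    qed
  qed
qed

text \<open>Composing \<open>G\<close> with the nearest-point projection onto the ball gives a
  bounded continuous field on the whole space. Up to time \<open>T\<close> its solution cannot leave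
  the ball, where the projection is the identity.\<close>

lemma peano_cball:
  fixes G :: "'a::euclidean_space \<Rightarrow> 'a"
  assumes "continuous_on (cball X R) G" and M: "\<And>x. x \<in> cball X R \<Longrightarrow> norm (G x) \<le> M"
    and "R \<ge> 0" "M * T \<le> R"
  shows "\<exists>Y. ode_solution (cball X R) G X T Y"
proof -
  define P where "P = closest_point (cball X R)"
  have P: "P x \<in> cball X R" for x
    using \<open>R \<ge> 0\<close> unfolding P_def by (intro closest_point_in_set) auto
  have id: "P x = x" if "x \<in> cball X R" for x
    using that by (simp add: P_def closest_point_self)
  have "continuous_on UNIV P"
    unfolding P_def using \<open>R \<ge> 0\<close> by (intro continuous_on_closest_point) auto
  then have "continuous_on UNIV (G \<circ> P)"
    using P assms(1) by (intro continuous_on_compose) (auto intro: continuous_on_subset)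
  moreover have "norm ((G \<circ> P) x) \<le> M" for x using M P by simp
  ultimately obtain Y where Y: "Y 0 = X" "\<And>r. r \<ge> 0 \<Longrightarrow> norm (Y r - X) \<le> M * r"
    "\<And>r. r \<ge> 0 \<Longrightarrow> (Y has_vector_derivative (G \<circ> P) (Y r)) (at r within {0..})"
    using peano_bounded by blast
  have M0: "M \<ge> 0" using M[of X] \<open>R \<ge> 0\<close> norm_ge_zero[of "G X"] by (simp del: norm_ge_zero)
  have inR: "Y r \<in> cball X R" if "r \<in> {0..T}" for r
  proof -
    have "norm (Y r - X) \<le> M * r" using Y(2) that by simp
    also have "\<dots> \<le> M * T" using that M0 by (intro mult_left_mono) auto
    finally show ?thesis using assms(4) by (simp add: dist_norm norm_minus_commute)
  qed
  have "(Y has_vector_derivative G (Y r)) (at r within {0..T})" if "r \<in> {0..T}" for r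
    using Y(3)[of r] that id[OF inR[OF that]] by (auto intro: has_vector_derivative_within_subset)
  then show ?thesis using Y(1) inR by (auto simp: ode_solution_def)
qed

subsection \<open>Second-order expansion of solutions\<close>

text \<open>The mean value inequality, with the derivative bounded only at interior times. The
  first-exit argument below can thus apply it without bounding the speed at the exit time
  itself.\<close>

lemma vector_derivative_bound:
  fixes f :: "real \<Rightarrow> 'a::real_inner"
  assumes "a \<le> b"
    and der: "\<And>r. r \<in> {a..b} \<Longrightarrow> (f has_vector_derivative f' r) (at r within {a..b})"
    and bnd: "\<And>r. a < r \<Longrightarrow> r < b \<Longrightarrow> norm (f' r) \<le> B"
  shows "norm (f b - f a) \<le> B * (b - a)"
proof (cases "a = b")
  case False
  then have "a < b" using assms(1) by simp
  moreover have "continuous_on {a..b} f"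
    using der by (meson continuous_on_eq_continuous_within has_vector_derivative_continuous)
  moreover have "(f has_derivative (\<lambda>h. h *\<^sub>R f' r)) (at r)" if "a < r" "r < b" for r
    using der[of r] that at_within_Icc_at[of a r b] by (auto simp: has_vector_derivative_def)
  ultimately obtain r where r: "r \<in> {a<..<b}" "norm (f b - f a) \<le> norm ((b - a) *\<^sub>R f' r)"
    using mvt_general[of a b f "\<lambda>r h. h *\<^sub>R f' r"] by blast
  have "norm ((b - a) *\<^sub>R f' r) = (b - a) * norm (f' r)"
    using \<open>a < b\<close> by simp
  also have "\<dots> \<le> (b - a) * B"
    using r(1) bnd \<open>a < b\<close> by (intro mult_left_mono) auto
  finally show ?thesis using r(2) by (simp add: mult.commute)
qed simp

text \<open>First-exit argument, valid for every solution: before leaving the open ball the speed is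
  at most \<open>M\<close>, so at the first exit time \<open>q\<close> the distance from
  \<open>X\<close> is at most \<open>M * q < R\<close>, a contradiction.\<close>

lemma ode_solution_near_start:
  fixes Y :: "real \<Rightarrow> 'a::real_inner"
  assumes sol: "ode_solution D G X T Y" and "R > 0"
    and M: "\<And>x. x \<in> cball X R \<Longrightarrow> norm (G x) \<le> M"
    and "M * T < R" and r: "r \<in> {0..T}"
  shows "norm (Y r - X) \<le> M * r" and "Y r \<in> cball X R"
proof -
  have Y0: "Y 0 = X"
    and der: "\<And>r. r \<in> {0..T} \<Longrightarrow> (Y has_vector_derivative G (Y r)) (at r within {0..T})"
    using sol by (auto simp: ode_solution_def)
  have M0: "M \<ge> 0" using M[of X] \<open>R > 0\<close> norm_ge_zero[of "G X"] by (simp del: norm_ge_zero)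
  have MR: "M * q < R" if "q \<in> {0..T}" for q
    using that M0 \<open>M * T < R\<close> mult_left_mono[of q T M] by simp
  have der': "(Y has_vector_derivative G (Y p)) (at p within {0..q})"
    if "q \<in> {0..T}" "p \<in> {0..q}" for p q
    using that by (intro has_vector_derivative_within_subset[OF der]) auto
  have inside: "norm (Y p - X) < R" if "p \<in> {0..T}" for p
  proof (rule ccontr)
    assume out: "\<not> norm (Y p - X) < R"
    \<comment> \<open>The times outside the open ball form a compact set, whose least element is the
      first exit time.\<close>
    define A where "A = {0..T} \<inter> (\<lambda>p. norm (Y p - X)) -` {R..}"
    have "continuous_on {0..T} Y"
      using der by (meson continuous_on_eq_continuous_within has_vector_derivative_continuous)
    then have "continuous_on {0..T} (\<lambda>p. norm (Y p - X))"
      by (intro continuous_intros)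
    then have "closed A"
      unfolding A_def by (intro continuous_closed_preimage) auto
    then have "compact A"
      by (metis A_def compact_Icc closed_Int_compact inf_commute inf.idem inf_assoc)
    moreover have "A \<noteq> {}" using out that by (auto simp: A_def)
    ultimately have "\<exists>q\<in>A. \<forall>p\<in>A. q \<le> p"
      by (rule compact_attains_inf)
    then obtain q where q: "q \<in> A" "\<And>p. p \<in> A \<Longrightarrow> q \<le> p"
      by blast
    have "norm (G (Y p)) \<le> M" if "0 < p" "p < q" for p
    proof (rule M)
      have "p \<notin> A" using q(2)[of p] that by auto
      then show "Y p \<in> cball X R"
        using q(1) that by (auto simp: A_def dist_norm norm_minus_commute)
    qed
    then have "norm (Y q - Y 0) \<le> M * (q - 0)"
      using q(1) der'[of q] by (intro vector_derivative_bound) (auto simp: A_def)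
    then show False using MR[of q] q(1) by (auto simp: A_def Y0)
  qed
  show "Y r \<in> cball X R"
    using inside[OF r] by (simp add: dist_norm norm_minus_commute)
  have "norm (G (Y p)) \<le> M" if "0 < p" "p < r" for p
    using inside[of p] that r by (intro M) (simp add: dist_norm norm_minus_commute)
  then have "norm (Y r - Y 0) \<le> M * (r - 0)"
    using r der'[of r] by (intro vector_derivative_bound) auto
  then show "norm (Y r - X) \<le> M * r" by (simp add: Y0)
qed

text \<open>The elapsed time \<open>r\<close> and the field parameter \<tau> stay separate under
  differentiation. At \<open>r = \<tau>\<close> the two last terms become the second-order terms
  with coefficients \<open>(1/2) *\<^sub>R C\<close> and \<open>D\<close>.\<close>

lemma has_vector_derivative_quadratic_remainder:
  fixes Y :: "real \<Rightarrow> 'a::real_normed_vector"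
  assumes der: "(Y has_vector_derivative Y') (at r within S)"
  shows "((\<lambda>r. (Y r - X - r *\<^sub>R B) - (r\<^sup>2 / 2) *\<^sub>R C - (r * \<tau>) *\<^sub>R D) has_vector_derivative
    Y' - B - r *\<^sub>R C - \<tau> *\<^sub>R D) (at r within S)"
proof -
  have scale: "((\<lambda>q. c q *\<^sub>R v) has_vector_derivative c' *\<^sub>R v) (at r within S)"
    if "(c has_real_derivative c') (at r within S)" for c c' and v :: 'a
    using has_vector_derivative_scaleR[OF that has_vector_derivative_const] by simp
  have "((\<lambda>r. (Y r - X - r *\<^sub>R B) - (r\<^sup>2 / 2) *\<^sub>R C - (r * \<tau>) *\<^sub>R D) has_vector_derivative
    Y' - 0 - 1 *\<^sub>R B - r *\<^sub>R C - \<tau> *\<^sub>R D) (at r within S)"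
    by (intro has_vector_derivative_diff has_vector_derivative_const der scale)
      (auto intro!: derivative_eq_intros)
  then show ?thesis by simp
qed

text \<open>Three passes, each feeding the next: a speed bound gives
  \<open>norm (Y r - X) \<le> 2 * M * r\<close>, continuity of \<Gamma>0 improves this to a small
  multiple of \<open>r\<close> for the first-order remainder \<open>W\<close>, and differentiability
  of \<Gamma>0 then makes the derivative of the second-order remainder \<open>Z\<close> at most
  \<epsilon> \<tau>. Integrating over time \<tau> yields the missing factor.\<close>

lemma ode_solution_expansion:
  fixes \<Gamma>0 \<Gamma>1 :: "'a::euclidean_space \<Rightarrow> 'a"
  assumes "open D" "X \<in> D" and A: "(\<Gamma>0 has_derivative A) (at X)"
    and c0: "continuous_on D \<Gamma>0" and c1: "continuous_on D \<Gamma>1" and "\<epsilon> > 0"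
  shows "\<forall>\<^sub>F \<tau> in at_right 0.
    (\<exists>Y. ode_solution D (\<lambda>Z. \<Gamma>0 Z + \<tau> *\<^sub>R \<Gamma>1 Z) X \<tau> Y) \<and>
    (\<forall>Y. ode_solution D (\<lambda>Z. \<Gamma>0 Z + \<tau> *\<^sub>R \<Gamma>1 Z) X \<tau> Y \<longrightarrow>
       norm (Y \<tau> - X - \<tau> *\<^sub>R \<Gamma>0 X - \<tau>\<^sup>2 *\<^sub>R (\<Gamma>1 X + (1/2) *\<^sub>R A (\<Gamma>0 X))) \<le> \<epsilon> * \<tau>\<^sup>2)"
proof -
  obtain R where R: "R > 0" "cball X R \<subseteq> D"
    using assms(1,2) open_contains_cball by blast
  have "bounded (\<Gamma>0 ` cball X R)" "bounded (\<Gamma>1 ` cball X R)"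
    using c0 c1 R(2)
    by (auto intro!: compact_imp_bounded compact_continuous_image intro: continuous_on_subset)
  then obtain M0 M1 where "\<forall>y\<in>\<Gamma>0 ` cball X R. norm y \<le> M0" "\<forall>y\<in>\<Gamma>1 ` cball X R. norm y \<le> M1"
    unfolding bounded_iff by blast
  then obtain M where M: "\<And>x. x \<in> cball X R \<Longrightarrow> norm (\<Gamma>0 x) \<le> M"
      "\<And>x. x \<in> cball X R \<Longrightarrow> norm (\<Gamma>1 x) \<le> M" "M > 0"
    using that[of "max 1 (max M0 M1)"] by (force simp: le_max_iff_disj)
  have linA: "bounded_linear A" using A has_derivative_bounded_linear by blast
  then obtain K where K: "K > 0" "\<And>v. norm (A v) \<le> norm v * K"
    using bounded_linear.pos_bounded by blast
  interpret A: bounded_linear A by fact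
  \<comment> \<open>The weights \<open>2 * M\<close>, \<open>2 * K\<close> and 1 belong to the three
    terms of \<open>Z'\<close>: the linearisation error, \<open>A (W r)\<close> and the variation of
    \<Gamma>1.\<close>
  define \<eta> where "\<eta> = \<epsilon> / (2 * M + 2 * K + 1)"
  have \<eta>: "\<eta> > 0" "(2 * M + 2 * K + 1) * \<eta> = \<epsilon>"
    using K M \<open>\<epsilon> > 0\<close> by (auto simp: \<eta>_def field_simps)
  have "isCont \<Gamma>0 X" "isCont \<Gamma>1 X"
    using c0 c1 assms(1,2) by (auto simp: continuous_on_eq_continuous_at)
  then obtain d0 d1 where d01: "d0 > 0" "\<And>y. norm (y - X) < d0 \<Longrightarrow> norm (\<Gamma>0 y - \<Gamma>0 X) < \<eta>"
      "d1 > 0" "\<And>y. norm (y - X) < d1 \<Longrightarrow> norm (\<Gamma>1 y - \<Gamma>1 X) < \<eta>"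
    using \<eta>(1) unfolding continuous_at_eps_delta dist_norm by metis
  obtain d2 where d2: "d2 > 0"
      "\<And>y. norm (y - X) < d2 \<Longrightarrow> norm (\<Gamma>0 y - \<Gamma>0 X - A (y - X)) \<le> \<eta> * norm (y - X)"
    using A \<eta>(1) unfolding has_derivative_at_alt by blast
  define \<delta> where "\<delta> = Min {R, d0, d1, d2}"
  have \<delta>: "\<delta> > 0" "\<delta> \<le> R" "\<delta> \<le> d0" "\<delta> \<le> d1" "\<delta> \<le> d2"
    using R d01 d2 by (auto simp: \<delta>_def)
  \<comment> \<open>The bound 1 makes the speed at most \<open>2 * M\<close>, the second keeps
    solutions within \<delta> of \<open>X\<close>, and the third makes the \<Gamma>1 term at most
    \<eta>.\<close>
  have "\<forall>\<^sub>F \<tau> in at_right (0::real). 0 < \<tau> \<and> \<tau> < 1 \<and> \<tau> < \<delta> / (2 * M) \<and> \<tau> < \<eta> / M"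
    using eventually_at_right_real[of 0 "Min {1, \<delta> / (2 * M), \<eta> / M}"] \<delta>(1) M(3) \<eta>(1)
    by (auto elim: eventually_mono)
  then show ?thesis
  proof (rule eventually_mono, elim conjE)
    fix \<tau> :: real
    assume \<tau>: "0 < \<tau>" "\<tau> < 1" "\<tau> < \<delta> / (2 * M)" "\<tau> < \<eta> / M"
    let ?G = "\<lambda>Z. \<Gamma>0 Z + \<tau> *\<^sub>R \<Gamma>1 Z"
    have \<tau>M: "2 * M * \<tau> < \<delta>" "M * \<tau> < \<eta>" using \<tau>(3,4) M(3) by (auto simp: field_simps)
    have G: "norm (?G x) \<le> 2 * M" if "x \<in> cball X R" for x
    proof -
      have "norm (?G x) \<le> M + 1 * M"
        using M(1,2)[OF that] \<tau> mult_mono[of \<tau> 1 "norm (\<Gamma>1 x)" M]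
        by (intro norm_triangle_mono) auto
      then show ?thesis by simp
    qed
    have "continuous_on (cball X R) ?G"
      using continuous_on_subset[OF c0 R(2)] continuous_on_subset[OF c1 R(2)]
      by (intro continuous_on_add continuous_on_scaleR continuous_on_const)
    then have "\<exists>Y. ode_solution (cball X R) ?G X \<tau> Y"
      by (rule peano_cball[OF _ G]) (use R \<tau>M \<delta> in auto)
    then have ex: "\<exists>Y. ode_solution D ?G X \<tau> Y"
      using R(2) unfolding ode_solution_def by blast
    moreover have "norm (Y \<tau> - X - \<tau> *\<^sub>R \<Gamma>0 X - \<tau>\<^sup>2 *\<^sub>R (\<Gamma>1 X + (1/2) *\<^sub>R A (\<Gamma>0 X))) \<le> \<epsilon> * \<tau>\<^sup>2"
      if sol: "ode_solution D ?G X \<tau> Y" for Y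
    proof -
      have Y0: "Y 0 = X"
        and der: "\<And>r. r \<in> {0..\<tau>} \<Longrightarrow> (Y has_vector_derivative ?G (Y r)) (at r within {0..\<tau>})"
        using sol by (auto simp: ode_solution_def)
      have Y1: "norm (Y r - X) \<le> 2 * M * r" and YR: "Y r \<in> cball X R" if "r \<in> {0..\<tau>}" for r
        using ode_solution_near_start[OF sol R(1) G _ that] \<tau>M \<delta> by auto
      have Y\<delta>: "norm (Y r - X) < \<delta>" if "r \<in> {0..\<tau>}" for r
      proof -
        have "2 * M * r \<le> 2 * M * \<tau>" using that M(3) by (intro mult_left_mono) auto
        then show ?thesis using Y1[OF that] \<tau>M by linarith
      qed
      define W where "W r = Y r - X - r *\<^sub>R \<Gamma>0 X" for r
      have W: "norm (W r) \<le> 2 * \<eta> * r" if r: "r \<in> {0..\<tau>}" for r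
      proof -
        have "norm (W r - W 0) \<le> 2 * \<eta> * (r - 0)"
        proof (rule vector_derivative_bound)
          show "(W has_vector_derivative (?G (Y p) - \<Gamma>0 X)) (at p within {0..r})" if "p \<in> {0..r}" for p
            unfolding W_def using that r
            by (auto intro!: derivative_eq_intros has_vector_derivative_within_subset[OF der])
          show "norm (?G (Y p) - \<Gamma>0 X) \<le> 2 * \<eta>" if "0 < p" "p < r" for p
          proof -
            have p: "p \<in> {0..\<tau>}" using that r by auto
            have "norm ((\<Gamma>0 (Y p) - \<Gamma>0 X) + \<tau> *\<^sub>R \<Gamma>1 (Y p)) \<le> \<eta> + \<tau> * M"
              using d01(2)[of "Y p"] Y\<delta>[OF p] \<delta> M(2)[OF YR[OF p]] \<tau>(1)
              by (intro norm_triangle_mono) (auto intro!: mult_left_mono)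
            then show ?thesis using \<tau>M by (simp add: algebra_simps)
          qed
        qed (use r in auto)
        then show ?thesis by (simp add: W_def Y0)
      qed
      define Z where "Z r = W r - (r\<^sup>2 / 2) *\<^sub>R A (\<Gamma>0 X) - (r * \<tau>) *\<^sub>R \<Gamma>1 X" for r
      \<comment> \<open>Since \<open>Y r - X\<close> equals \<open>W r\<close> plus \<open>r\<close>
        times \<open>\<Gamma>0 X\<close>, adding and subtracting \<open>A (Y r - X)\<close> cancels
        the term \<open>r *\<^sub>R A (\<Gamma>0 X)\<close> and leaves only small
        quantities.\<close>
      define Z' where "Z' r = (\<Gamma>0 (Y r) - \<Gamma>0 X - A (Y r - X)) + A (W r) + \<tau> *\<^sub>R (\<Gamma>1 (Y r) - \<Gamma>1 X)" for r
      have "norm (Z \<tau> - Z 0) \<le> (\<epsilon> * \<tau>) * (\<tau> - 0)"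
      proof (rule vector_derivative_bound)
        show "(Z has_vector_derivative Z' r) (at r within {0..\<tau>})" if "r \<in> {0..\<tau>}" for r
        proof -
          have "(Z has_vector_derivative
              ?G (Y r) - \<Gamma>0 X - r *\<^sub>R A (\<Gamma>0 X) - \<tau> *\<^sub>R \<Gamma>1 X) (at r within {0..\<tau>})"
            unfolding Z_def W_def by (rule has_vector_derivative_quadratic_remainder[OF der[OF that]])
          moreover have "Z' r = ?G (Y r) - \<Gamma>0 X - r *\<^sub>R A (\<Gamma>0 X) - \<tau> *\<^sub>R \<Gamma>1 X"
            by (simp add: Z'_def W_def A.diff A.scaleR scaleR_right_diff_distrib)
          ultimately show ?thesis by simp
        qed
        show "norm (Z' r) \<le> \<epsilon> * \<tau>" if "0 < r" "r < \<tau>" for r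
        proof -
          have r: "r \<in> {0..\<tau>}" using that by auto
          have "norm (\<Gamma>0 (Y r) - \<Gamma>0 X - A (Y r - X)) \<le> \<eta> * norm (Y r - X)"
            using d2(2) Y\<delta>[OF r] \<delta> by auto
          also have "\<dots> \<le> \<eta> * (2 * M * \<tau>)"
            using order_trans[OF Y1[OF r] mult_left_mono[of r \<tau> "2 * M"]] that M(3) \<eta>(1)
            by (intro mult_left_mono) auto
          finally have 1: "norm (\<Gamma>0 (Y r) - \<Gamma>0 X - A (Y r - X)) \<le> \<eta> * (2 * M * \<tau>)" .
          have "norm (A (W r)) \<le> norm (W r) * K" by (rule K)
          also have "\<dots> \<le> (2 * \<eta> * \<tau>) * K"
            using order_trans[OF W[OF r] mult_left_mono[of r \<tau> "2 * \<eta>"]] that K(1) \<eta>(1)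
            by (intro mult_right_mono) auto
          finally have 2: "norm (A (W r)) \<le> (2 * \<eta> * \<tau>) * K" .
          have 3: "norm (\<tau> *\<^sub>R (\<Gamma>1 (Y r) - \<Gamma>1 X)) \<le> \<tau> * \<eta>"
            using d01(4)[of "Y r"] Y\<delta>[OF r] \<delta> \<tau>(1) by (auto intro!: mult_left_mono)
          have "norm (Z' r) \<le> \<eta> * (2 * M * \<tau>) + (2 * \<eta> * \<tau>) * K + \<tau> * \<eta>"
            unfolding Z'_def by (intro norm_triangle_mono 1 2 3)
          also have "\<dots> = ((2 * M + 2 * K + 1) * \<eta>) * \<tau>" by (simp add: algebra_simps)
          finally show ?thesis by (simp add: \<eta>(2))
        qed
      qed (use \<tau> in auto)
      moreover have "Z 0 = 0" by (simp add: Z_def W_def Y0)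
      moreover have "Z \<tau> = Y \<tau> - X - \<tau> *\<^sub>R \<Gamma>0 X - \<tau>\<^sup>2 *\<^sub>R (\<Gamma>1 X + (1/2) *\<^sub>R A (\<Gamma>0 X))"
        by (simp add: Z_def W_def algebra_simps power2_eq_square)
      ultimately show ?thesis by (simp add: power2_eq_square mult.assoc)
    qed
    ultimately show "(\<exists>Y. ode_solution D ?G X \<tau> Y) \<and> (\<forall>Y. ode_solution D ?G X \<tau> Y \<longrightarrow>
       norm (Y \<tau> - X - \<tau> *\<^sub>R \<Gamma>0 X - \<tau>\<^sup>2 *\<^sub>R (\<Gamma>1 X + (1/2) *\<^sub>R A (\<Gamma>0 X))) \<le> \<epsilon> * \<tau>\<^sup>2)"
      by blast
  qed
qed

text \<open>Solution and template share the first-order term \<open>\<Gamma>0 X\<close>, so it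
  suffices that their second-order coefficients agree. Each expansion error receives half of
  \<epsilon>.\<close>

lemma resolution_odeI:
  fixes \<Gamma>0 \<Gamma>1 :: "'a::euclidean_space \<Rightarrow> 'a"
  assumes "open D" and A: "\<And>X. X \<in> D \<Longrightarrow> (\<Gamma>0 has_derivative A X) (at X)"
    and c1: "continuous_on D \<Gamma>1"
    and \<Phi>0: "\<And>X. X \<in> D \<Longrightarrow> \<Phi> X 0 = X"
    and \<Phi>: "\<And>X. X \<in> D \<Longrightarrow>
      ((\<lambda>\<tau>. (1 / \<tau>\<^sup>2) *\<^sub>R (\<Phi> X \<tau> - X - \<tau> *\<^sub>R \<Gamma>0 X)) \<longlongrightarrow> \<Gamma>1 X + (1/2) *\<^sub>R A X (\<Gamma>0 X)) (at_right 0)"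
  shows "resolution_ode D \<Phi> \<Gamma>0 \<Gamma>1"
  unfolding resolution_ode_def
proof (intro conjI ballI allI impI \<Phi>0)
  fix X and \<epsilon> :: real assume X: "X \<in> D" and \<epsilon>: "\<epsilon> > 0"
  let ?S = "\<lambda>\<tau>. ode_solution D (\<lambda>Z. \<Gamma>0 Z + \<tau> *\<^sub>R \<Gamma>1 Z) X \<tau>"
  define L where "L = \<Gamma>1 X + (1/2) *\<^sub>R A X (\<Gamma>0 X)"
  have c0: "continuous_on D \<Gamma>0"
    using A by (meson continuous_at_imp_continuous_on has_derivative_continuous)
  have "\<forall>\<^sub>F \<tau> in at_right 0. dist ((1 / \<tau>\<^sup>2) *\<^sub>R (\<Phi> X \<tau> - X - \<tau> *\<^sub>R \<Gamma>0 X)) L < \<epsilon> / 2"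
    using tendstoD[OF \<Phi>[OF X], of "\<epsilon> / 2"] \<epsilon> by (simp add: L_def)
  moreover have "\<forall>\<^sub>F \<tau> in at_right 0. (\<exists>Y. ?S \<tau> Y) \<and>
      (\<forall>Y. ?S \<tau> Y \<longrightarrow> norm (Y \<tau> - X - \<tau> *\<^sub>R \<Gamma>0 X - \<tau>\<^sup>2 *\<^sub>R L) \<le> \<epsilon> / 2 * \<tau>\<^sup>2)"
    unfolding L_def using \<epsilon> by (intro ode_solution_expansion[OF assms(1) X A[OF X] c0 c1]) simp
  moreover have "\<forall>\<^sub>F \<tau> in at_right 0. \<tau> > (0::real)"
    by (rule eventually_at_right_less)
  ultimately have "\<forall>\<^sub>F \<tau> in at_right 0. (\<exists>Y. ?S \<tau> Y) \<and>
      (\<forall>Y. ?S \<tau> Y \<longrightarrow> norm (Y \<tau> - \<Phi> X \<tau>) \<le> \<epsilon> * \<tau>\<^sup>2)"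
  proof eventually_elim
    case (elim \<tau>)
    let ?d = "\<Phi> X \<tau> - X - \<tau> *\<^sub>R \<Gamma>0 X - \<tau>\<^sup>2 *\<^sub>R L"
    have "?d = \<tau>\<^sup>2 *\<^sub>R ((1 / \<tau>\<^sup>2) *\<^sub>R (\<Phi> X \<tau> - X - \<tau> *\<^sub>R \<Gamma>0 X) - L)"
      using elim(3) by (simp add: scaleR_right_diff_distrib)
    then have "norm ?d = \<tau>\<^sup>2 * dist ((1 / \<tau>\<^sup>2) *\<^sub>R (\<Phi> X \<tau> - X - \<tau> *\<^sub>R \<Gamma>0 X)) L"
      by (simp add: dist_norm)
    also have "\<dots> \<le> \<tau>\<^sup>2 * (\<epsilon> / 2)"
      using elim(1) by (intro mult_left_mono) auto
    finally have d: "norm ?d \<le> \<epsilon> / 2 * \<tau>\<^sup>2" by (simp add: mult.commute)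
    have "norm (Y \<tau> - \<Phi> X \<tau>) \<le> \<epsilon> * \<tau>\<^sup>2" if "?S \<tau> Y" for Y
    proof -
      have "norm (Y \<tau> - X - \<tau> *\<^sub>R \<Gamma>0 X - \<tau>\<^sup>2 *\<^sub>R L) \<le> \<epsilon> / 2 * \<tau>\<^sup>2"
        using elim(2) that by blast
      then have "norm ((Y \<tau> - X - \<tau> *\<^sub>R \<Gamma>0 X - \<tau>\<^sup>2 *\<^sub>R L) - ?d) \<le> \<epsilon> / 2 * \<tau>\<^sup>2 + \<epsilon> / 2 * \<tau>\<^sup>2"
        by (rule order_trans[OF norm_triangle_ineq4 add_mono[OF _ d]])
      then show ?thesis by simp
    qed
    then show ?case using elim(2) by blast
  qed
  \<comment> \<open>Transfers "eventually in \<tau>" to "eventually in s" along \<tau> = sqrt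
    s.\<close>
  moreover have "filterlim sqrt (at_right 0) (at_right 0)"
    unfolding filterlim_at
  proof
    show "(sqrt \<longlongrightarrow> 0) (at_right 0)"
      using tendsto_real_sqrt[OF tendsto_ident_at, of 0] by simp
    show "\<forall>\<^sub>F s in at_right 0. sqrt s \<in> {0<..} \<and> sqrt s \<noteq> 0"
      using eventually_at_right_less by eventually_elim simp
  qed
  ultimately have "\<forall>\<^sub>F s in at_right 0. (\<exists>Y. ?S (sqrt s) Y) \<and>
      (\<forall>Y. ?S (sqrt s) Y \<longrightarrow> norm (Y (sqrt s) - \<Phi> X (sqrt s)) \<le> \<epsilon> * (sqrt s)\<^sup>2)"
    by (rule eventually_compose_filterlim)
  moreover have "\<forall>\<^sub>F s in at_right 0. s > (0::real)"
    by (rule eventually_at_right_less)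
  ultimately show "\<forall>\<^sub>F s in at_right 0. (\<exists>Y. ?S (sqrt s) Y) \<and>
      (\<forall>Y. ?S (sqrt s) Y \<longrightarrow> norm (Y (sqrt s) - \<Phi> X (sqrt s)) \<le> \<epsilon> * s)"
    by eventually_elim simp
qed

subsection \<open>Strongly convex functions and conjugates\<close>

lemma grad_eqI: "GDERIV f x :> D \<Longrightarrow> grad f x = D"
  unfolding grad_def
proof (rule the_equality)
  fix D' assume "GDERIV f x :> D" "GDERIV f x :> D'"
  then have "(\<lambda>h. h \<bullet> D') = (\<lambda>h. h \<bullet> D)"
    unfolding gderiv_def by (rule has_derivative_unique[rotated])
  then have "(D' - D) \<bullet> D' = (D' - D) \<bullet> D" by metis
  then have "(D' - D) \<bullet> (D' - D) = 0" by (simp add: inner_diff_right)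
  then show "D' = D" by simp
qed

text \<open>Riesz representation: the derivative \<open>f'\<close> is the inner product with
  \<open>adjoint f' 1\<close>, so the description operator in \<open>grad\<close> denotes a genuine
  gradient.\<close>

lemma GDERIV_grad:
  fixes f :: "'a::euclidean_space \<Rightarrow> real"
  assumes "f differentiable at x"
  shows "GDERIV f x :> grad f x"
proof -
  obtain f' where f': "(f has_derivative f') (at x)"
    using assms by (auto simp: differentiable_def)
  then have "f' h = h \<bullet> adjoint f' 1" for h
    using adjoint_works[of f' h 1] has_derivative_linear by fastforce
  then have "GDERIV f x :> adjoint f' 1"
    using f' unfolding gderiv_def by (metis (no_types, lifting) ext)
  then show ?thesis using grad_eqI by metis
qed

text \<open>The first-order condition, free of convexity so that it serves both for a function and
  for its conjugate.\<close>

lemma grad_minimiser_diff_linear: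
  fixes f :: "'a::euclidean_space \<Rightarrow> real"
  assumes "f differentiable at x" and min: "\<And>v. f x - p \<bullet> x \<le> f v - p \<bullet> v"
  shows "grad f x = p"
proof -
  have "((\<lambda>v. f v - p \<bullet> v) has_derivative (\<lambda>h. h \<bullet> grad f x - p \<bullet> h)) (at x)"
    using GDERIV_grad[OF assms(1)] unfolding gderiv_def by (auto intro!: derivative_eq_intros)
  then have "(\<lambda>h. h \<bullet> grad f x - p \<bullet> h) = (\<lambda>h. 0)"
    using min by (intro has_derivative_local_min always_eventually) auto
  then have "(grad f x - p) \<bullet> grad f x - p \<bullet> (grad f x - p) = 0" by metis
  then have "(grad f x - p) \<bullet> (grad f x - p) = 0" by (simp add: inner_diff_right inner_commute)
  then show ?thesis by simp
qed

text \<open>Divide the convexity inequality on the segment from \<open>x\<close> to \<open>y\<close>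
  by \<open>u\<close> and let \<open>u\<close> tend to 0 from the right. The factor
  \<open>1 - u\<close> tends to 1, so the full modulus survives.\<close>

lemma strongly_convex_tangent_le:
  fixes f :: "'a::euclidean_space \<Rightarrow> real"
  assumes "f differentiable at x" and sc: "strongly_convex \<mu> f"
  shows "f x + grad f x \<bullet> (y - x) + \<mu> / 2 * (norm (y - x))\<^sup>2 \<le> f y"
proof -
  have "((\<lambda>u. f (x + u *\<^sub>R (y - x))) has_derivative (\<lambda>u. (u *\<^sub>R (y - x)) \<bullet> grad f x)) (at 0)"
  proof (rule has_derivative_compose[where g = f])
    show "((\<lambda>u. x + u *\<^sub>R (y - x)) has_derivative (\<lambda>u. u *\<^sub>R (y - x))) (at (0::real))"
      by (auto intro!: derivative_eq_intros)
    show "(f has_derivative (\<lambda>h. h \<bullet> grad f x)) (at (x + 0 *\<^sub>R (y - x)))"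
      using GDERIV_grad[OF assms(1)] by (simp add: gderiv_def)
  qed
  then have "((\<lambda>u. f (x + u *\<^sub>R (y - x))) has_field_derivative grad f x \<bullet> (y - x)) (at 0)"
    unfolding has_field_derivative_def
    by (rule has_derivative_eq_rhs) (auto simp: inner_commute mult.commute)
  then have "((\<lambda>u. (f (x + u *\<^sub>R (y - x)) - f x) / u) \<longlongrightarrow> grad f x \<bullet> (y - x)) (at 0)"
    by (simp add: DERIV_def)
  then have lhs: "((\<lambda>u. (f (x + u *\<^sub>R (y - x)) - f x) / u) \<longlongrightarrow> grad f x \<bullet> (y - x)) (at_right 0)"
    by (rule filterlim_at_split[THEN iffD1, THEN conjunct2])
  have rhs: "((\<lambda>u. f y - f x - \<mu> / 2 * (1 - u) * (norm (x - y))\<^sup>2) \<longlongrightarrow>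
      f y - f x - \<mu> / 2 * (1 - 0) * (norm (x - y))\<^sup>2) (at_right 0)"
    by (intro tendsto_intros)
  have "\<forall>\<^sub>F u in at_right (0::real). 0 < u \<and> u < 1"
    using eventually_at_right_real[of 0 "1::real"] by simp
  then have "\<forall>\<^sub>F u in at_right 0.
      (f (x + u *\<^sub>R (y - x)) - f x) / u \<le> f y - f x - \<mu> / 2 * (1 - u) * (norm (x - y))\<^sup>2"
  proof eventually_elim
    case (elim u)
    have "f ((1 - u) *\<^sub>R x + u *\<^sub>R y) \<le> (1 - u) * f x + u * f y - \<mu> / 2 * u * (1 - u) * (norm (x - y))\<^sup>2"
      using sc elim unfolding strongly_convex_def by simp
    moreover have "(1 - u) *\<^sub>R x + u *\<^sub>R y = x + u *\<^sub>R (y - x)" by (simp add: algebra_simps)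
    ultimately have "f (x + u *\<^sub>R (y - x)) - f x \<le> u * (f y - f x - \<mu> / 2 * (1 - u) * (norm (x - y))\<^sup>2)"
      by (simp add: algebra_simps)
    then show ?case using elim by (simp add: pos_divide_le_eq mult.commute)
  qed
  then have "grad f x \<bullet> (y - x) \<le> f y - f x - \<mu> / 2 * (1 - 0) * (norm (x - y))\<^sup>2"
    by (rule tendsto_le[OF trivial_limit_at_right_real rhs lhs])
  then show ?thesis by (simp add: norm_minus_commute)
qed

text \<open>A minimiser on \<open>cball 0 B\<close> is global: \<open>B\<close> is the radius beyond
  which the quadratic term of the tangent bound at 0 outweighs the linear one, so values outside are
  at least the value at 0.\<close>

lemma strongly_convex_minimiser_exists:
  fixes f :: "'a::euclidean_space \<Rightarrow> real"
  assumes diff: "\<And>x. f differentiable at x" and sc: "strongly_convex 1 f"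
  obtains x where "\<And>v. f x - p \<bullet> x \<le> f v - p \<bullet> v"
proof -
  define B where "B = 2 * norm (grad f 0 - p)"
  have "continuous_on (cball 0 B) (\<lambda>v. f v - p \<bullet> v)"
    using diff by (intro continuous_intros)
      (auto intro!: continuous_at_imp_continuous_on differentiable_imp_continuous_within)
  moreover have "cball 0 B \<noteq> ({} :: 'a set)" by (simp add: B_def)
  ultimately obtain x where x: "\<And>v. v \<in> cball 0 B \<Longrightarrow> f x - p \<bullet> x \<le> f v - p \<bullet> v"
    using continuous_attains_inf[OF compact_cball] by blast
  show thesis
  proof
    fix v
    show "f x - p \<bullet> x \<le> f v - p \<bullet> v"
    proof (cases "norm v \<le> B")
      case True
      then show ?thesis using x by simp
    next
      case False
      have "norm v * norm (grad f 0 - p) \<le> norm v * (1/2 * norm v)"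
        using False by (intro mult_left_mono) (auto simp: B_def)
      moreover have "- (norm (grad f 0 - p) * norm v) \<le> (grad f 0 - p) \<bullet> v"
        using Cauchy_Schwarz_ineq2[of "grad f 0 - p" v] by (simp add: abs_le_iff)
      ultimately have "0 \<le> (grad f 0 - p) \<bullet> v + 1/2 * (norm v)\<^sup>2"
        by (simp add: power2_eq_square mult.commute)
      moreover have "f 0 + grad f 0 \<bullet> v + 1/2 * (norm v)\<^sup>2 \<le> f v"
        using strongly_convex_tangent_le[OF diff sc, of 0 v] by simp
      ultimately have "f 0 \<le> f v - p \<bullet> v" by (simp add: inner_diff_left)
      moreover have "f x - p \<bullet> x \<le> f 0" using x[of 0] by (simp add: B_def)
      ultimately show ?thesis by simp
    qed
  qed
qed

text \<open>Turns both the supremum in \<open>conjugate\<close> and the dual averaging argmin into a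
  gradient equation.\<close>

lemma strongly_convex_minimiser_iff:
  fixes f :: "'a::euclidean_space \<Rightarrow> real"
  assumes diff: "\<And>x. f differentiable at x" and sc: "strongly_convex 1 f"
  shows "(\<forall>v. f x - p \<bullet> x \<le> f v - p \<bullet> v) \<longleftrightarrow> grad f x = p"
proof
  assume "grad f x = p"
  then have "f x + p \<bullet> (v - x) + 1/2 * (norm (v - x))\<^sup>2 \<le> f v" for v
    using strongly_convex_tangent_le[OF diff sc, of x v] by simp
  moreover have "0 \<le> 1/2 * (norm (v - x))\<^sup>2" for v by simp
  ultimately show "\<forall>v. f x - p \<bullet> x \<le> f v - p \<bullet> v"
    by (smt (verit) inner_diff_right)
qed (auto intro: grad_minimiser_diff_linear diff)

text \<open>If \<open>grad f x = p\<close>, then \<open>x\<close> attains the supremum defining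
  \<open>conjugate f p\<close>; by the Fenchel-Young inequality \<open>p\<close> minimises
  \<open>conjugate f q - x \<bullet> q\<close> over \<open>q\<close>, and the first-order condition
  applies to the conjugate. The converse follows because some \<open>w\<close> with
  \<open>grad f w = p\<close> exists.\<close>

lemma grad_conjugate_iff:
  fixes f :: "'a::euclidean_space \<Rightarrow> real"
  assumes diff: "\<And>x. f differentiable at x" and sc: "strongly_convex 1 f"
    and diff': "\<And>p. conjugate f differentiable at p"
  shows "grad (conjugate f) p = x \<longleftrightarrow> grad f x = p"
proof -
  have grad_conj: "grad (conjugate f) p = x" if "grad f x = p" for p x
  proof -
    \<comment> \<open>The real-valued supremum is meaningful only for a set bounded above; a
      minimiser provides the bound.\<close>
    have bdd: "bdd_above (range (\<lambda>v. q \<bullet> v - f v))" for q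
    proof -
      obtain w where "\<And>v. f w - q \<bullet> w \<le> f v - q \<bullet> v"
        using strongly_convex_minimiser_exists[OF diff sc] by blast
      then have "q \<bullet> v - f v \<le> q \<bullet> w - f w" for v by (smt (verit))
      then show ?thesis by (rule bdd_aboveI2)
    qed
    have lower: "q \<bullet> x - f x \<le> conjugate f q" for q
      unfolding conjugate_def using bdd by (intro cSUP_upper) auto
    have "p \<bullet> v - f v \<le> p \<bullet> x - f x" for v
      using strongly_convex_minimiser_iff[OF diff sc, of x p] that by (smt (verit))
    then have "conjugate f p \<le> p \<bullet> x - f x"
      unfolding conjugate_def by (intro cSUP_least) auto
    then have "conjugate f p - x \<bullet> p \<le> conjugate f q - x \<bullet> q" for q
      using lower[of q] by (simp add: inner_commute)
    then show ?thesis by (intro grad_minimiser_diff_linear diff')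
  qed
  moreover obtain w where "\<And>v. f w - p \<bullet> w \<le> f v - p \<bullet> v"
    using strongly_convex_minimiser_exists[OF diff sc] by blast
  then have "grad f w = p" using strongly_convex_minimiser_iff[OF diff sc] by blast
  ultimately show ?thesis by metis
qed

text \<open>Completing the square: up to a constant the objective is half the squared distance to
  \<open>x - s *\<^sub>R g\<close>.\<close>

lemma is_arg_min_gradient_step:
  fixes g x w :: "'a::real_inner"
  shows "is_arg_min (\<lambda>v. s * (g \<bullet> (v - x)) + 1/2 * (norm (v - x))\<^sup>2) (\<lambda>_. True) w \<longleftrightarrow> w = x - s *\<^sub>R g"
proof -
  define Q where "Q v = s * (g \<bullet> (v - x)) + 1/2 * (norm (v - x))\<^sup>2" for v
  have Q: "Q v = 1/2 * (norm (v - (x - s *\<^sub>R g)))\<^sup>2 - 1/2 * s\<^sup>2 * (norm g)\<^sup>2" for v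
    unfolding Q_def power2_norm_eq_inner
    by (simp add: inner_diff_left inner_diff_right inner_add_left inner_add_right inner_commute
        algebra_simps power2_eq_square)
  have "Q w \<le> Q (x - s *\<^sub>R g) \<longleftrightarrow> w = x - s *\<^sub>R g"
    unfolding Q by auto
  moreover have "Q (x - s *\<^sub>R g) \<le> Q v" for v
    unfolding Q by simp
  ultimately have "(\<forall>v. \<not> Q v < Q w) \<longleftrightarrow> w = x - s *\<^sub>R g"
    by (metis linorder_not_le order_refl)
  then show ?thesis unfolding is_arg_min_def Q_def by simp
qed

text \<open>The weighted sum is affine in \<open>v\<close>. Its constant part moves into
  \<open>C\<close>, and its linear part tilts \<open>f\<close> by the vector
  \<open>p\<close>.\<close>

lemma is_arg_min_dual_averaging_step:
  fixes f :: "'a::euclidean_space \<Rightarrow> real" and g x :: "'i \<Rightarrow> 'a"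
  assumes "\<And>x. f differentiable at x" and "strongly_convex 1 f" and "s > 0"
  shows "is_arg_min (\<lambda>v. 1 / s * f v + (\<Sum>i\<in>I. c i * (b i + g i \<bullet> (v - x i)))) (\<lambda>_. True) w
    \<longleftrightarrow> grad f w = - s *\<^sub>R (\<Sum>i\<in>I. c i *\<^sub>R g i)"
proof -
  define p where "p = - s *\<^sub>R (\<Sum>i\<in>I. c i *\<^sub>R g i)"
  define C where "C = (\<Sum>i\<in>I. c i * (b i - g i \<bullet> x i))"
  have "(\<Sum>i\<in>I. c i * (b i + g i \<bullet> (v - x i))) = C - 1 / s * (p \<bullet> v)" for v
    using \<open>s > 0\<close>
    by (simp add: p_def C_def inner_sum_left inner_diff_right algebra_simps sum.distrib sum_subtractf)
  then have "1 / s * f v + (\<Sum>i\<in>I. c i * (b i + g i \<bullet> (v - x i))) = C + 1 / s * (f v - p \<bullet> v)" for v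
    by (simp add: algebra_simps)
  then have "is_arg_min (\<lambda>v. 1 / s * f v + (\<Sum>i\<in>I. c i * (b i + g i \<bullet> (v - x i)))) (\<lambda>_. True) w
      \<longleftrightarrow> (\<forall>v. f w - p \<bullet> w \<le> f v - p \<bullet> v)"
    using \<open>s > 0\<close> by (auto simp: is_arg_min_def not_less divide_le_cancel)
  then show ?thesis
    unfolding strongly_convex_minimiser_iff[OF assms(1,2)] by (simp only: p_def)
qed

subsection \<open>Accelerated mirror descent\<close>

text \<open>At \<tau> = sqrt s and t = (k + 3) \<tau> one has 2 \<tau> / t = 2 / (k + 3), its
  complement is (k + 1) / (k + 3), and \<tau> (t / 2 - \<tau>) = s (k + 1) / 2. These are the
  weights of the method.\<close>

lemma amd_template_step:
  fixes F \<phi> :: "'a::euclidean_space \<Rightarrow> real" and x z :: 'a and k :: nat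
  assumes "s > 0"
  defines "z' \<equiv> z - (s * (real k + 1) / 2) *\<^sub>R grad F x"
  shows "amd_template F \<phi> (x, z, (real k + 3) * sqrt s) (sqrt s) =
    ((2 / (real k + 3)) *\<^sub>R grad (conjugate \<phi>) z'
       + ((real k + 1) / (real k + 3)) *\<^sub>R (x - s *\<^sub>R grad F x),
     z', (real (Suc k) + 3) * sqrt s)"
proof -
  have t: "2 * sqrt s / ((real k + 3) * sqrt s) = 2 / (real k + 3)"
    using \<open>s > 0\<close> by simp
  have c: "1 - 2 / (real k + 3) = (real k + 1) / (real k + 3)"
    by (simp add: field_simps)
  have "sqrt s * ((real k + 3) * sqrt s / 2 - sqrt s) = (sqrt s)\<^sup>2 * (real k + 1) / 2"
    by (simp add: field_simps power2_eq_square)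
  then have z: "sqrt s * ((real k + 3) * sqrt s / 2 - sqrt s) = s * (real k + 1) / 2"
    using \<open>s > 0\<close> by simp
  have "(sqrt s)\<^sup>2 = s" using \<open>s > 0\<close> by simp
  then show ?thesis
    unfolding amd_template_def prod.case t c z z'_def
    by (simp add: algebra_simps)
qed

lemma amd_states_iff_template:
  fixes F \<phi> :: "'a::euclidean_space \<Rightarrow> real"
  assumes diff: "\<And>x. \<phi> differentiable at x" and sc: "strongly_convex 1 \<phi>"
    and diff': "\<And>p. conjugate \<phi> differentiable at p" and s: "s > 0"
  shows "amd_states F \<phi> s X \<longleftrightarrow>
    (\<exists>x0. X 0 = (x0, 0, 3 * sqrt s)) \<and> (\<forall>k. X (Suc k) = amd_template F \<phi> (X k) (sqrt s))"
proof
  note zstep = is_arg_min_dual_averaging_step[OF diff sc s,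
      where c = "\<lambda>i. (real i + 1) / 2"]
  note conj = grad_conjugate_iff[OF diff sc diff']
  {
    assume "amd_states F \<phi> s X"
    then obtain x y zh z where m: "amd_method F \<phi> s x y zh" and z0: "z 0 = 0"
      and z: "\<And>k. z k = grad \<phi> (zh k)" and X: "\<And>k. X k = (x k, z k, (real k + 3) * sqrt s)"
      unfolding amd_states_def by auto
    have y: "y (Suc k) = x k - s *\<^sub>R grad F (x k)"
      and zS: "z (Suc k) = - s *\<^sub>R (\<Sum>i=0..k. ((real i + 1) / 2) *\<^sub>R grad F (x i))"
      and x: "x (Suc k) = (2 / (real k + 3)) *\<^sub>R zh (Suc k) + ((real k + 1) / (real k + 3)) *\<^sub>R y (Suc k)"
      for k
      using m unfolding amd_method_def is_arg_min_gradient_step zstep z by auto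
    \<comment> \<open>The optimality condition gives \<open>z\<close> as a cumulative sum. For
      \<open>k = 0\<close> the preceding sum is empty and is matched by \<open>z 0 = 0\<close>;
      otherwise the last summand splits off.\<close>
    have "z (Suc k) = z k - (s * (real k + 1) / 2) *\<^sub>R grad F (x k)" for k
      by (cases k) (simp_all only: zS z0 sum.atLeast0_atMost_Suc, simp_all add: scaleR_right_distrib)
    moreover have "zh k = grad (conjugate \<phi>) (z k)" for k
      using conj[of "z k" "zh k"] z by simp
    ultimately have "X (Suc k) = amd_template F \<phi> (X k) (sqrt s)" for k
      unfolding X amd_template_step[OF s] x y by simp
    then show "(\<exists>x0. X 0 = (x0, 0, 3 * sqrt s)) \<and> (\<forall>k. X (Suc k) = amd_template F \<phi> (X k) (sqrt s))"
      using X[of 0] z0 by simp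
  next
    assume "(\<exists>x0. X 0 = (x0, 0, 3 * sqrt s)) \<and> (\<forall>k. X (Suc k) = amd_template F \<phi> (X k) (sqrt s))"
    then obtain x0 where X0: "X 0 = (x0, 0, 3 * sqrt s)"
      and XS: "\<And>k. X (Suc k) = amd_template F \<phi> (X k) (sqrt s)" by blast
    define x z where "x k = fst (X k)" and "z k = fst (snd (X k))" for k
    \<comment> \<open>At \<open>k = 0\<close> truncated subtraction makes this refer to
      \<open>x 0\<close>; \<open>amd_method\<close> constrains \<open>y\<close> only at
      successors.\<close>
    define y where "y k = x (k - 1) - s *\<^sub>R grad F (x (k - 1))" for k
    \<comment> \<open>Defined at 0 as well, so that inversion of the gradients also yields the
      normalisation \<open>grad \<phi> (zh 0) = z 0\<close>.\<close>
    define zh where "zh k = grad (conjugate \<phi>) (z k)" for k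
    have X: "X k = (x k, z k, (real k + 3) * sqrt s)" for k
    proof (induction k)
      case 0
      then show ?case by (simp add: x_def z_def X0)
    next
      case (Suc k)
      have "snd (snd (X (Suc k))) = (real (Suc k) + 3) * sqrt s"
        unfolding XS Suc amd_template_step[OF s] by simp
      then show ?case by (metis x_def z_def prod.collapse)
    qed
    have step: "(x (Suc k), z (Suc k)) =
      ((2 / (real k + 3)) *\<^sub>R grad (conjugate \<phi>) (z k - (s * (real k + 1) / 2) *\<^sub>R grad F (x k))
         + ((real k + 1) / (real k + 3)) *\<^sub>R (x k - s *\<^sub>R grad F (x k)),
       z k - (s * (real k + 1) / 2) *\<^sub>R grad F (x k))" for k
      using XS[of k] unfolding X amd_template_step[OF s] by simp
    have z0: "z 0 = 0" by (simp add: z_def X0)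
    have zS: "z (Suc k) = - s *\<^sub>R (\<Sum>i=0..k. ((real i + 1) / 2) *\<^sub>R grad F (x i))" for k
    proof (induction k)
      case 0
      then show ?case using step[of 0] by (simp add: z0)
    next
      case (Suc k)
      have "z (Suc (Suc k)) = z (Suc k) - (s * (real (Suc k) + 1) / 2) *\<^sub>R grad F (x (Suc k))"
        using step[of "Suc k"] by simp
      then show ?case
        by (simp only: Suc sum.atLeast0_atMost_Suc) (simp add: scaleR_right_distrib)
    qed
    have zh: "z k = grad \<phi> (zh k)" for k
      using conj[of "z k" "zh k"] by (simp add: zh_def)
    have "amd_method F \<phi> s x y zh"
      unfolding amd_method_def is_arg_min_gradient_step zstep
    proof (intro allI conjI)
      fix k
      show "y (Suc k) = x k - s *\<^sub>R grad F (x k)" by (simp add: y_def)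
      show "grad \<phi> (zh (Suc k)) = - s *\<^sub>R (\<Sum>i=0..k. ((real i + 1) / 2) *\<^sub>R grad F (x i))"
        by (simp only: zh[symmetric] zS)
      show "x (Suc k) = (2 / (real k + 3)) *\<^sub>R zh (Suc k) + ((real k + 1) / (real k + 3)) *\<^sub>R y (Suc k)"
        using step[of k] by (simp add: y_def zh_def)
    qed
    then show "amd_states F \<phi> s X"
      unfolding amd_states_def using z0 zh X by blast
  }
qed

section \<open>Second-order expansion of the template and the resolution ODE\<close>

lemma C2_has_derivative_grad:
  assumes "C2 f"
  shows "(grad f has_derivative (*v) (hessian f x)) (at x)"
  using assms jacobian_works[of "grad f" "at x"] by (simp add: C2_def hessian_def)

lemma continuous_on_matrix_vector_mult:
  fixes A :: "'a::topological_space \<Rightarrow> real^'n^'m"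
  assumes "continuous_on S A" "continuous_on S v"
  shows "continuous_on S (\<lambda>x. A x *v v x)"
  unfolding matrix_vector_mult_def
  by (intro continuous_intros assms)

lemma has_vector_derivative_at_right_0:
  assumes "(f has_vector_derivative v) (at 0)"
  shows "((\<lambda>\<tau>. (1 / \<tau>) *\<^sub>R (f \<tau> - f 0)) \<longlongrightarrow> v) (at_right 0)"
proof -
  have "(f has_derivative (\<lambda>h. h *\<^sub>R v)) (at_right 0)"
    using assms by (auto simp: has_vector_derivative_def intro: has_derivative_at_withinI)
  then have "((\<lambda>\<tau>. (1 / norm (\<tau> - 0)) *\<^sub>R (f \<tau> - (f 0 + (\<tau> - 0) *\<^sub>R v))) \<longlongrightarrow> 0) (at_right 0)"
    by (simp only: has_derivative_within)
  then have "((\<lambda>\<tau>. (1 / norm (\<tau> - 0)) *\<^sub>R (f \<tau> - (f 0 + (\<tau> - 0) *\<^sub>R v)) + v) \<longlongrightarrow> 0 + v) (at_right 0)"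
    by (intro tendsto_intros)
  moreover have "\<forall>\<^sub>F \<tau> in at_right (0::real).
      (1 / norm (\<tau> - 0)) *\<^sub>R (f \<tau> - (f 0 + (\<tau> - 0) *\<^sub>R v)) + v = (1 / \<tau>) *\<^sub>R (f \<tau> - f 0)"
    using eventually_at_right_less by eventually_elim (simp add: algebra_simps)
  ultimately have "((\<lambda>\<tau>. (1 / \<tau>) *\<^sub>R (f \<tau> - f 0)) \<longlongrightarrow> 0 + v) (at_right 0)"
    by (rule Lim_transform_eventually)
  then show ?thesis by simp
qed

text \<open>The mirror map enters the template with a factor \<tau>, so its first-order expansion
  along \<open>w\<close> suffices: 2 / t times the derivative along -(t / 2) \<open>grad F x\<close>
  gives the Hessian term. The gradient step gives \<open>- grad F x\<close>, the dual update is
  exactly quadratic in \<tau>, and time is exactly linear.\<close>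

lemma amd_template_second_order:
  fixes F \<phi> :: "real^'n \<Rightarrow> real"
  assumes "C2 (conjugate \<phi>)" and "t > 0"
  shows "((\<lambda>\<tau>. (1 / \<tau>\<^sup>2) *\<^sub>R (amd_template F \<phi> (x, z, t) \<tau> - (x, z, t)
        - \<tau> *\<^sub>R ((2 / t) *\<^sub>R (grad (conjugate \<phi>) z - x), - (t / 2) *\<^sub>R grad F x, 1)))
      \<longlongrightarrow> (- (hessian (conjugate \<phi>) z *v grad F x) - grad F x, grad F x, 0)) (at_right 0)"
proof -
  define g H f where "g = grad (conjugate \<phi>)" and "H = hessian (conjugate \<phi>) z" and "f = grad F x"
  define w where "w \<tau> = z - (\<tau> * (t / 2 - \<tau>)) *\<^sub>R f" for \<tau>
  have "(w has_derivative (\<lambda>h. h *\<^sub>R (- (t / 2) *\<^sub>R f))) (at 0)"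
    unfolding w_def by (auto intro!: derivative_eq_intros)
  moreover have "(g has_derivative (*v) H) (at (w 0))"
    using C2_has_derivative_grad[OF assms(1), of z] by (simp add: g_def H_def w_def)
  ultimately have "((\<lambda>\<tau>. g (w \<tau>)) has_derivative (\<lambda>h. H *v (h *\<^sub>R (- (t / 2) *\<^sub>R f)))) (at 0)"
    by (rule has_derivative_compose)
  then have "((\<lambda>\<tau>. g (w \<tau>)) has_vector_derivative H *v (- (t / 2) *\<^sub>R f)) (at 0)"
    unfolding has_vector_derivative_def matrix_vector_mult_scaleR .
  then have "((\<lambda>\<tau>. (1 / \<tau>) *\<^sub>R (g (w \<tau>) - g z)) \<longlongrightarrow> H *v (- (t / 2) *\<^sub>R f)) (at_right 0)"
    by (auto dest!: has_vector_derivative_at_right_0 simp: w_def)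
  then have "((\<lambda>\<tau>. (2 / t) *\<^sub>R ((1 / \<tau>) *\<^sub>R (g (w \<tau>) - g z)) - (1 - 2 * \<tau> / t) *\<^sub>R f) \<longlongrightarrow>
      (2 / t) *\<^sub>R (H *v (- (t / 2) *\<^sub>R f)) - (1 - 2 * 0 / t) *\<^sub>R f) (at_right 0)"
    using \<open>t > 0\<close> by (intro tendsto_intros) auto
  moreover have "(2 / t) *\<^sub>R (H *v (- (t / 2) *\<^sub>R f)) = - (H *v f)"
    using \<open>t > 0\<close> by (simp add: matrix_vector_mult_scaleR del: scaleR_minus_left)
  ultimately have lim: "((\<lambda>\<tau>. ((2 / t) *\<^sub>R ((1 / \<tau>) *\<^sub>R (g (w \<tau>) - g z)) - (1 - 2 * \<tau> / t) *\<^sub>R f, f, 0)) \<longlongrightarrow>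
      (- (H *v f) - f, f, 0::real)) (at_right 0)"
    by (intro tendsto_Pair tendsto_const) simp
  have "\<forall>\<^sub>F \<tau> in at_right (0::real).
      ((2 / t) *\<^sub>R ((1 / \<tau>) *\<^sub>R (g (w \<tau>) - g z)) - (1 - 2 * \<tau> / t) *\<^sub>R f, f, 0)
      = (1 / \<tau>\<^sup>2) *\<^sub>R (amd_template F \<phi> (x, z, t) \<tau> - (x, z, t)
        - \<tau> *\<^sub>R ((2 / t) *\<^sub>R (g z - x), - (t / 2) *\<^sub>R f, 1))"
    using eventually_at_right_less
  proof eventually_elim
    case (elim \<tau>)
    have "(1 - 2 * \<tau> / t) *\<^sub>R x + (2 * \<tau> / t) *\<^sub>R g (w \<tau>) - (\<tau>\<^sup>2 * (1 - 2 * \<tau> / t)) *\<^sub>R f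
        - x - \<tau> *\<^sub>R (2 / t) *\<^sub>R (g z - x)
        = \<tau>\<^sup>2 *\<^sub>R ((2 / t) *\<^sub>R ((1 / \<tau>) *\<^sub>R (g (w \<tau>) - g z)) - (1 - 2 * \<tau> / t) *\<^sub>R f)"
      using elim by (simp add: algebra_simps power2_eq_square)
    moreover have "w \<tau> - z - \<tau> *\<^sub>R (- (t / 2) *\<^sub>R f) = \<tau>\<^sup>2 *\<^sub>R f"
      by (simp add: w_def algebra_simps power2_eq_square)
    ultimately show ?case
      using elim by (simp add: amd_template_def flip: g_def f_def w_def)
  qed
  then show ?thesis
    using lim unfolding g_def H_def f_def by (rule Lim_transform_eventually[rotated])
qed

theorem theorem3p5:
  fixes F \<phi> :: "real^'n \<Rightarrow> real"
  assumes "convex_on UNIV F" and "C2 F"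
    and "C1 \<phi>" and "strongly_convex 1 \<phi>" and "C2 (conjugate \<phi>)"
  shows
    "(\<forall>s>0. \<forall>X. amd_states F \<phi> s X \<longleftrightarrow>
        (\<exists>x0. X 0 = (x0, 0, 3 * sqrt s)) \<and>
        (\<forall>k. X (Suc k) = amd_template F \<phi> (X k) (sqrt s))) \<and>
     resolution_ode {(x, z, t). t > 0} (amd_template F \<phi>)
       (\<lambda>(x, z, t).
          ((2 / t) *\<^sub>R (grad (conjugate \<phi>) z - x),
           - (t / 2) *\<^sub>R grad F x,
           1))
       (\<lambda>(x, z, t). (1 / 2) *\<^sub>R
          (- (hessian (conjugate \<phi>) z *v grad F x) - 2 *\<^sub>R grad F x
             + (6 / t\<^sup>2) *\<^sub>R (grad (conjugate \<phi>) z - x),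
           (5 / 2) *\<^sub>R grad F x + hessian F x *v (grad (conjugate \<phi>) z - x),
           0))"
    (is "?states \<and> resolution_ode ?D _ ?\<Gamma>0 ?\<Gamma>1")
proof
  let ?g = "grad (conjugate \<phi>)" and ?H = "hessian (conjugate \<phi>)"
  show ?states
    using amd_states_iff_template[of \<phi>] assms by (simp add: C1_def C2_def)
  \<comment> \<open>The derivative of the leading field at (x, z, t) in the direction (dx, dz, dt).
    The direction used below is the leading field itself, hence dt = 1.\<close>
  define A where "A = (\<lambda>(x, z, t) (dx, dz, dt).
    ((2 / t) *\<^sub>R (?H z *v dz - dx) - (2 * dt / t\<^sup>2) *\<^sub>R (?g z - x),
     - (t / 2) *\<^sub>R (hessian F x *v dx) - (dt / 2) *\<^sub>R grad F x, 0 :: real))"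
  show "resolution_ode ?D (amd_template F \<phi>) ?\<Gamma>0 ?\<Gamma>1"
  proof (rule resolution_odeI[where A = A])
    have "?D = {X. 0 < snd (snd X)}" by auto
    then show "open ?D" by (simp only:) (intro open_Collect_less continuous_intros)
  next
    fix X assume "X \<in> ?D"
    then obtain x z t where X: "X = (x, z, t)" and t: "t > 0" by auto
    have g': "((\<lambda>p. ?g (fst (snd p))) has_derivative (\<lambda>d. ?H z *v fst (snd d))) (at (x, z, t))"
      by (rule has_derivative_compose[where f = "\<lambda>p. fst (snd p)"])
        (auto simp: X intro!: derivative_eq_intros C2_has_derivative_grad assms)
    have f': "((\<lambda>p. grad F (fst p)) has_derivative (\<lambda>d. hessian F x *v fst d)) (at (x, z, t))"
      by (rule has_derivative_compose[where f = fst])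
        (auto simp: X intro!: derivative_eq_intros C2_has_derivative_grad assms)
    show "(?\<Gamma>0 has_derivative A X) (at X)"
      unfolding case_prod_unfold A_def
      using t by (auto simp: X field_simps power2_eq_square intro!: derivative_eq_intros g' f' ext)
    show "amd_template F \<phi> X 0 = X" by (simp add: X amd_template_def)
    have "?\<Gamma>1 X + (1 / 2) *\<^sub>R A X (?\<Gamma>0 X)
        = (- (?H z *v grad F x) - grad F x, grad F x, 0)"
    proof -
      have lin: "?H z *v (- (t / 2) *\<^sub>R grad F x) = - (t / 2) *\<^sub>R (?H z *v grad F x)"
        "hessian F x *v ((2 / t) *\<^sub>R (?g z - x)) = (2 / t) *\<^sub>R (hessian F x *v (?g z - x))"
        by (rule matrix_vector_mult_scaleR)+
      \<comment> \<open>In the first identity \<open>a\<close> is the conjugate Hessian applied to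
        \<open>grad F x\<close> and \<open>b\<close> is the mirror displacement; differentiating 2 /
        t and the field's -x term produces -6 / t^2 times \<open>b\<close>, which cancels the term
        of \<Gamma>1. In the second, \<open>a\<close> is the Hessian of \<open>F\<close> applied to
        that displacement, and 5/4 - 1/4 leaves one gradient.\<close>
      have "(1 / 2) *\<^sub>R (- a - 2 *\<^sub>R f + (6 / t\<^sup>2) *\<^sub>R b)
          + (1 / 2) *\<^sub>R ((2 / t) *\<^sub>R (- (t / 2) *\<^sub>R a - (2 / t) *\<^sub>R b) - (2 * 1 / t\<^sup>2) *\<^sub>R b) = - a - f"
        and "(1 / 2) *\<^sub>R ((5 / 2) *\<^sub>R f + a)
          + (1 / 2) *\<^sub>R (- (t / 2) *\<^sub>R (2 / t) *\<^sub>R a - (1 / 2) *\<^sub>R f) = f" for a b f :: "real^'n"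
        using t by (simp_all add: vec_eq_iff field_simps power2_eq_square)
      then show ?thesis
        unfolding X A_def prod.case scaleR_Pair add_Pair lin by simp
    qed
    then show "((\<lambda>\<tau>. (1 / \<tau>\<^sup>2) *\<^sub>R (amd_template F \<phi> X \<tau> - X - \<tau> *\<^sub>R ?\<Gamma>0 X)) \<longlongrightarrow>
        ?\<Gamma>1 X + (1 / 2) *\<^sub>R A X (?\<Gamma>0 X)) (at_right 0)"
      using amd_template_second_order[OF assms(5) t, of F x z] by (simp only: X prod.case)
  next
    have fst: "continuous_on ?D (\<lambda>p. fst p)" and snd: "continuous_on ?D (\<lambda>p. fst (snd p))"
      by (intro continuous_intros)+
    \<comment> \<open>Continuity of the two Hessians enters here; the derivative of the leading
      field used only differentiability of the gradients.\<close>
    have "continuous_on UNIV ?g" "continuous_on UNIV ?H"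
      "continuous_on UNIV (grad F)" "continuous_on UNIV (hessian F)"
      using assms by (auto simp: C1_def C2_def)
    note this[THEN continuous_on_compose2, OF _ subset_UNIV]
    note this(1,2)[OF snd] this(3,4)[OF fst]
    then show "continuous_on ?D ?\<Gamma>1"
      unfolding case_prod_unfold
      by (intro continuous_intros continuous_on_matrix_vector_mult) auto
  qed
qed

end
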